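(* Let $(\mathbb R^n,F)$ be a (not necessarily reversible) Finsler-Minkowski space, and let $d_F(p,q)=F(q-p)$ for $p,q\in\mathbb R^n$. Then for every two (nonempty) convex and $\mathbb R^n$-proximinal sets $S_1,S_2\subset\mathbb R^n$ and every $q\in S_1$: (i) the statements $(DP_1^+)$ $q=(P_{S_1}^-\circ P_{S_2}^+)(q)$, and $(DP_2^+)$ $d_F(q,P_{S_2}^+(q))\le d_F(z_1,z_2)$ for all $z_1\in S_1$, $z_2\in S_2$, are equivalent; (ii) the statements $(DP_1^-)$ $q=(P_{S_1}^+\circ P_{S_2}^-)(q)$, and $(DP_2^-)$ $d_F(P_{S_2}^-(q),q)\le d_F(z_2,z_1)$ for all $z_1\in S_1$, $z_2\in S_2$, are equivalent.
   Context: Finsler-Minkowski spaces. A positively homogeneous Minkowski norm is a function $F:\mathbb R^n\to[0,\infty)$ such that: (a) $F\in C^2(\mathbb R^n\setminus\{0\})$; (b) $F(ty)=tF(y)$ for all $t\ge 0$ and $y\in\mathbb R^n$; (c) the Hessian matrix $g_y=\nabla^2(F^2/2)(y)$ is positive definite for all $y\ne 0$. The pair $(\mathbb R^n,F)$ is then called a Finsler-Minkowski space. It is reversible if moreover $F(ty)=|t|F(y)$ for all $t\in\mathbb R$; in general $d_F(p,q)=F(q-p)$ is only a quasi-metric and may be non-symmetric. Projections. For a nonempty set $S\subset\mathbb R^n$ and $q\in\mathbb R^n$, the forward and backward metric projections of $q$ to $S$ are $P_S^+(q)=\{s_f\in S: d_F(q,s_f)=\inf_{s\in S}d_F(q,s)\}$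 and $P_S^-(q)=\{s_b\in S: d_F(s_b,q)=\inf_{s\in S}d_F(s,q)\}$. $S$ is $\mathbb R^n$-proximinal if these projections are nonempty for every $q\in\mathbb R^n$. For convex, $\mathbb R^n$-proximinal $S$, the sets $P_S^+(q)$ and $P_S^-(q)$ are singletons for every $q\in\mathbb R^n$, and each is identified with its unique point. "Convex" is meant in the usual sense in $\mathbb R^n$. *)

theory Defs
  imports "HOL-Analysis.Analysis"
begin

definition grad :: "(real^'n \<Rightarrow> real) \<Rightarrow> real^'n \<Rightarrow> real^'n" where
  "grad f x = (\<chi> i. frechet_derivative f (at x) (axis i 1))"

definition hessian :: "(real^'n \<Rightarrow> real) \<Rightarrow> real^'n \<Rightarrow> real^'n^'n" where
  "hessian f x = jacobian (grad f) (at x)"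

text \<open>
  Derivatives are taken in the whole space, so this is the usual class \<open>C\<^sup>2(U)\<close> for
  open \<open>U\<close>. Both differentiability clauses are needed, because \<^const>\<open>frechet_derivative\<close>
  is an arbitrary function wherever no derivative exists.
\<close>
definition C2_on :: "(real^'n) set \<Rightarrow> (real^'n \<Rightarrow> real) \<Rightarrow> bool" where
  "C2_on U f \<longleftrightarrow>
     (\<forall>x\<in>U. f differentiable (at x)) \<and>
     (\<forall>x\<in>U. grad f differentiable (at x)) \<and>
     continuous_on U (hessian f)"

text \<open>Symmetry is not demanded: it is automatic for the Hessian of a \<open>C\<^sup>2\<close> function.\<close>
definition pos_def :: "real^'n^'n \<Rightarrow> bool" where
  "pos_def A \<longleftrightarrow> (\<forall>v. v \<noteq> 0 \<longrightarrow> v \<bullet> (A *v v) > 0)"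

definition minkowski_norm :: "(real^'n \<Rightarrow> real) \<Rightarrow> bool" where
  "minkowski_norm F \<longleftrightarrow>
     (\<forall>y. 0 \<le> F y) \<and>
     C2_on (UNIV - {0}) F \<and>
     (\<forall>t y. 0 \<le> t \<longrightarrow> F (t *\<^sub>R y) = t * F y) \<and>
     (\<forall>y. y \<noteq> 0 \<longrightarrow> pos_def (hessian (\<lambda>x. (F x)\<^sup>2 / 2) y))"

definition dist_F :: "(real^'n \<Rightarrow> real) \<Rightarrow> real^'n \<Rightarrow> real^'n \<Rightarrow> real" where
  "dist_F F p q = F (q - p)"

definition fwd_proj_set :: "(real^'n \<Rightarrow> real) \<Rightarrow> (real^'n) set \<Rightarrow> real^'n \<Rightarrow> (real^'n) set" where
  "fwd_proj_set F S q = {s \<in> S. dist_F F q s = (INF s'\<in>S. dist_F F q s')}"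

definition bwd_proj_set :: "(real^'n \<Rightarrow> real) \<Rightarrow> (real^'n) set \<Rightarrow> real^'n \<Rightarrow> (real^'n) set" where
  "bwd_proj_set F S q = {s \<in> S. dist_F F s q = (INF s'\<in>S. dist_F F s' q)}"

definition proximinal :: "(real^'n \<Rightarrow> real) \<Rightarrow> (real^'n) set \<Rightarrow> bool" where
  "proximinal F S \<longleftrightarrow> (\<forall>q. fwd_proj_set F S q \<noteq> {} \<and> bwd_proj_set F S q \<noteq> {})"

text \<open>
  The projections as points. These are meaningful when the projection sets are singletons,
  which is the case for convex proximinal sets in a Finsler-Minkowski space.
\<close>
definition fwd_proj :: "(real^'n \<Rightarrow> real) \<Rightarrow> (real^'n) set \<Rightarrow> real^'n \<Rightarrow> real^'n" where
  "fwd_proj F S q = the_elem (fwd_proj_set F S q)"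

definition bwd_proj :: "(real^'n \<Rightarrow> real) \<Rightarrow> (real^'n) set \<Rightarrow> real^'n \<Rightarrow> real^'n" where
  "bwd_proj F S q = the_elem (bwd_proj_set F S q)"

end

theory Submission
  imports Defs
begin

text \<open>
  Put \<open>G = F\<^sup>2 / 2\<close>. Minimising \<open>F\<close> and minimising \<open>G\<close> are the same, and \<open>G\<close> is strictly
  convex in the sense that its graph lies strictly above each tangent hyperplane at a nonzero point
  (lemma \<open>energy_above_tangent\<close>). This strict inequality has two uses.

  It makes minimisers of \<open>F\<close> on a convex set unique (\<open>minimizer_unique\<close>), so that the projections
  are determined by their minimality. If the pair \<open>(q, p)\<close> realises the distance from \<open>S1\<close> to
  \<open>S2\<close>, then in particular \<open>q\<close> is nearest to \<open>p\<close> within \<open>S1\<close>, and by uniqueness it is the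
  projection of \<open>p\<close>.

  Conversely, let each of \<open>p\<close> and \<open>q\<close> be a projection of the other, and \<open>x = p - q\<close>. If
  \<open>x = 0\<close>, the distance is zero. Otherwise the first-order conditions for
  the two projections say that the same functional \<open>dG(x)\<close> is nonnegative on \<open>z2 - p\<close> and on
  \<open>q - z1\<close>, for all \<open>z1\<close> in \<open>S1\<close> and \<open>z2\<close> in \<open>S2\<close>; adding them shows it
  nonnegative on \<open>(z2 - z1) - x\<close>, and the tangent inequality gives \<open>G (z2 - z1) \<ge> G x\<close>
  (\<open>separate_minimizer_is_joint\<close>). Linearity of the derivative is what turns optimality in each
  variable separately into joint optimality. Both parts of the theorem are instances, with the two
  sets exchanged, so the asymmetry of \<open>F\<close> does no harm.
\<close>

section \<open>The energy of a Minkowski norm and its gradient\<close>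

definition energy :: "(real^'n \<Rightarrow> real) \<Rightarrow> real^'n \<Rightarrow> real" where
  "energy F x = (F x)\<^sup>2 / 2"

lemma has_derivative_grad:
  fixes f :: "real^'n \<Rightarrow> real"
  assumes "f differentiable (at x)"
  shows "(f has_derivative (\<lambda>h. grad f x \<bullet> h)) (at x)"
proof -
  let ?D = "frechet_derivative f (at x)"
  have D: "(f has_derivative ?D) (at x)"
    using assms frechet_derivative_works by blast
  have "?D h = grad f x \<bullet> h" for h
  proof -
    have "?D h = ?D (\<Sum>i\<in>UNIV. h $ i *\<^sub>R axis i 1)"
      using basis_expansion[of h] by (simp add: scalar_mult_eq_scaleR)
    also have "\<dots> = (\<Sum>i\<in>UNIV. h $ i * ?D (axis i 1))"
      using has_derivative_linear[OF D] by (simp add: linear_sum linear_scale)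
    also have "\<dots> = grad f x \<bullet> h"
      by (simp add: grad_def inner_vec_def mult.commute)
    finally show ?thesis .
  qed
  then have "?D = (\<lambda>h. grad f x \<bullet> h)" by blast
  with D show ?thesis by simp
qed

context
  fixes F :: "real^'n \<Rightarrow> real"
  assumes mink: "minkowski_norm F"
begin

lemma norm_nonneg: "0 \<le> F y"
  and norm_scale: "0 \<le> t \<Longrightarrow> F (t *\<^sub>R y) = t * F y"
  using mink by (auto simp: minkowski_norm_def)

lemma norm_zero: "F 0 = 0"
  using norm_scale[of 0 0] by simp

lemma energy_scale: "0 \<le> t \<Longrightarrow> energy F (t *\<^sub>R y) = t\<^sup>2 * energy F y"
  by (simp add: energy_def norm_scale power_mult_distrib)

lemma energy_le_iff: "energy F x \<le> energy F y \<longleftrightarrow> F x \<le> F y"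
  using norm_nonneg by (simp add: energy_def)

lemma energy_nonneg: "0 \<le> energy F x"
  by (simp add: energy_def)

lemma energy_differentiable:
  assumes "x \<noteq> 0"
  shows "energy F differentiable (at x)" and "grad (energy F) x = F x *\<^sub>R grad F x"
proof -
  have "F differentiable (at x)"
    using mink assms by (auto simp: minkowski_norm_def C2_on_def)
  then have "((\<lambda>x. (F x)\<^sup>2 / 2) has_derivative (\<lambda>h. F x * (grad F x \<bullet> h))) (at x)"
    by (auto intro!: derivative_eq_intros has_derivative_grad)
  then have D: "(energy F has_derivative (\<lambda>h. F x * (grad F x \<bullet> h))) (at x)"
    by (simp add: energy_def[abs_def])
  then show "energy F differentiable (at x)"
    by (auto simp: differentiable_def)
  show "grad (energy F) x = F x *\<^sub>R grad F x"
    using frechet_derivative_at[OF D, symmetric]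
    by (simp add: grad_def vec_eq_iff inner_axis)
qed

lemma energy_grad_has_derivative:
  assumes "x \<noteq> 0"
  shows "(grad (energy F) has_derivative (\<lambda>h. hessian (energy F) x *v h)) (at x)"
proof -
  have "F differentiable (at x)" "grad F differentiable (at x)"
    using mink assms by (auto simp: minkowski_norm_def C2_on_def)
  then obtain A B where "(F has_derivative A) (at x)" "(grad F has_derivative B) (at x)"
    by (auto simp: differentiable_def)
  then have "((\<lambda>x. F x *\<^sub>R grad F x) has_derivative (\<lambda>h. F x *\<^sub>R B h + A h *\<^sub>R grad F x)) (at x)"
    by (rule has_derivative_scaleR)
  then have "(grad (energy F) has_derivative (\<lambda>h. F x *\<^sub>R B h + A h *\<^sub>R grad F x)) (at x)"
    by (rule has_derivative_transform_within_open[of _ _ _ _ "- {0}"])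
      (use assms in \<open>auto simp: energy_differentiable(2)\<close>)
  then have "grad (energy F) differentiable (at x)"
    by (auto simp: differentiable_def)
  then show ?thesis
    by (simp add: hessian_def jacobian_works)
qed

lemma energy_hessian_pos:
  assumes "x \<noteq> 0" "w \<noteq> 0"
  shows "w \<bullet> (hessian (energy F) x *v w) > 0"
  using mink assms by (auto simp: minkowski_norm_def pos_def_def energy_def[abs_def])

lemma energy_line_derivative:
  assumes "x + t *\<^sub>R w \<noteq> 0"
  shows "((\<lambda>t. energy F (x + t *\<^sub>R w)) has_real_derivative grad (energy F) (x + t *\<^sub>R w) \<bullet> w) (at t)"
proof -
  have "((\<lambda>t. x + t *\<^sub>R w) has_derivative (\<lambda>h. h *\<^sub>R w)) (at t)"
    by (auto intro!: derivative_eq_intros)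
  from has_derivative_compose[OF this has_derivative_grad[OF energy_differentiable(1)[OF assms]]]
  show ?thesis
    by (simp add: has_field_derivative_def mult.commute[of _ "_ \<bullet> _"])
qed

text \<open>Euler's identity for a function that is homogeneous of degree two.\<close>

lemma energy_euler:
  assumes "y \<noteq> 0"
  shows "grad (energy F) y \<bullet> y = 2 * energy F y"
proof -
  have "((\<lambda>t. energy F (0 + t *\<^sub>R y)) has_real_derivative grad (energy F) y \<bullet> y) (at 1)"
    using energy_line_derivative[of 0 1 y] assms by simp
  then have "((\<lambda>t. t\<^sup>2 * energy F y) has_real_derivative grad (energy F) y \<bullet> y) (at 1)"
    by (rule has_field_derivative_transform_within_open[of _ _ _ "{0<..}"])
      (auto simp: energy_scale)
  moreover have "((\<lambda>t. t\<^sup>2 * energy F y) has_real_derivative 2 * energy F y) (at 1)"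
    by (auto intro!: derivative_eq_intros)
  ultimately show ?thesis
    by (rule DERIV_unique)
qed


section \<open>Strict convexity\<close>

lemma energy_grad_strict_mono:
  assumes "w \<noteq> 0" "0 < s" and off: "\<And>t. 0 \<le> t \<Longrightarrow> t \<le> s \<Longrightarrow> x + t *\<^sub>R w \<noteq> 0"
  shows "grad (energy F) x \<bullet> w < grad (energy F) (x + s *\<^sub>R w) \<bullet> w"
proof -
  let ?\<psi> = "\<lambda>t. grad (energy F) (x + t *\<^sub>R w) \<bullet> w"
  have "?\<psi> 0 < ?\<psi> s"
  proof (rule DERIV_pos_imp_increasing[OF \<open>0 < s\<close>])
    fix t assume t: "0 \<le> t" "t \<le> s"
    let ?H = "hessian (energy F) (x + t *\<^sub>R w)"
    have "((\<lambda>t. x + t *\<^sub>R w) has_derivative (\<lambda>h. h *\<^sub>R w)) (at t)"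
      by (auto intro!: derivative_eq_intros)
    from has_derivative_compose[OF this energy_grad_has_derivative[OF off[OF t]]]
    have "(?\<psi> has_derivative (\<lambda>h. (?H *v (h *\<^sub>R w)) \<bullet> w)) (at t)"
      by (rule has_derivative_inner_left)
    then have "(?\<psi> has_real_derivative w \<bullet> (?H *v w)) (at t)"
      by (simp add: has_field_derivative_def matrix_vector_mult_scaleR inner_commute
          mult.commute[of _ "_ \<bullet> _"])
    then show "\<exists>D. (?\<psi> has_real_derivative D) (at t) \<and> 0 < D"
      using energy_hessian_pos[OF off[OF t] \<open>w \<noteq> 0\<close>] by blast
  qed
  then show ?thesis by simp
qed

text \<open>
  Nonnegativity is improved to positivity by the Hessian: on the ray through \<open>y\<close> the energy is
  \<open>t\<^sup>2 * energy F y\<close>, whose derivative would not increase if \<open>energy F y\<close> vanished.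
\<close>

lemma energy_pos:
  assumes "y \<noteq> 0"
  shows "0 < energy F y"
proof -
  have "y + t *\<^sub>R y \<noteq> 0" if "0 \<le> t" for t :: real
  proof -
    have "y + t *\<^sub>R y = (1 + t) *\<^sub>R y" by (simp add: scaleR_left_distrib)
    then show ?thesis using assms that by simp
  qed
  then have "grad (energy F) y \<bullet> y < grad (energy F) (2 *\<^sub>R y) \<bullet> y"
    using energy_grad_strict_mono[of y 1 y] assms by (simp add: scaleR_2)
  moreover have "grad (energy F) (2 *\<^sub>R y) \<bullet> y = 4 * energy F y"
    using energy_euler[of "2 *\<^sub>R y"] assms by (simp add: energy_scale)
  ultimately show ?thesis
    using energy_euler[OF assms] by simp
qed

lemma norm_pos: "y \<noteq> 0 \<Longrightarrow> 0 < F y"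
  using energy_pos[of y] norm_nonneg[of y] by (cases "F y = 0") (auto simp: energy_def)

text \<open>
  If the segment from \<open>y\<close> to \<open>v\<close> avoids the origin, the Hessian controls the energy on all of it
  and the mean value theorem applies. Otherwise \<open>v\<close> is a nonpositive multiple of \<open>y\<close>, and there
  Euler's identity makes the tangent function negative, while the energy is nonnegative.
\<close>

lemma energy_above_tangent:
  assumes "y \<noteq> 0" "v \<noteq> y"
  shows "energy F y + grad (energy F) y \<bullet> (v - y) < energy F v"
proof (cases "\<exists>t. 0 \<le> t \<and> t \<le> 1 \<and> y + t *\<^sub>R (v - y) = 0")
  case True
  then obtain t where t: "0 \<le> t" "t \<le> 1" "y + t *\<^sub>R (v - y) = 0" by blast
  with \<open>y \<noteq> 0\<close> have "t \<noteq> 0" by auto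
  have "t *\<^sub>R (v - y) = - y"
    using t(3) by (simp add: add_eq_0_iff)
  then have "t * (grad (energy F) y \<bullet> (v - y)) = - (2 * energy F y)"
    using energy_euler[OF \<open>y \<noteq> 0\<close>] by (metis inner_minus_right inner_scaleR_right)
  then have "grad (energy F) y \<bullet> (v - y) = - (2 * energy F y) / t"
    using \<open>t \<noteq> 0\<close> by (simp add: field_simps)
  also have "\<dots> \<le> - (2 * energy F y)"
    using t \<open>t \<noteq> 0\<close> energy_pos[OF \<open>y \<noteq> 0\<close>] by (simp add: field_simps)
  finally show ?thesis
    using energy_pos[OF \<open>y \<noteq> 0\<close>] energy_nonneg[of v] by linarith
next
  case False
  let ?w = "v - y"
  have off: "y + t *\<^sub>R ?w \<noteq> 0" if "0 \<le> t" "t \<le> 1" for t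
    using False that by blast
  have "\<exists>\<xi>. 0 < \<xi> \<and> \<xi> < 1 \<and> energy F (y + 1 *\<^sub>R ?w) - energy F (y + 0 *\<^sub>R ?w)
      = (1 - 0) * (grad (energy F) (y + \<xi> *\<^sub>R ?w) \<bullet> ?w)"
    by (rule MVT2) (auto intro!: energy_line_derivative[OF off])
  then obtain \<xi> where "0 < \<xi>" "\<xi> < 1"
    and "energy F v - energy F y = grad (energy F) (y + \<xi> *\<^sub>R ?w) \<bullet> ?w"
    by auto
  moreover have "grad (energy F) y \<bullet> ?w < grad (energy F) (y + \<xi> *\<^sub>R ?w) \<bullet> ?w"
    using \<open>0 < \<xi>\<close> \<open>\<xi> < 1\<close> \<open>v \<noteq> y\<close> by (intro energy_grad_strict_mono off) auto
  ultimately show ?thesis by linarith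
qed


section \<open>Minimisers on convex sets\<close>

text \<open>
  At two distinct minimisers the energy would lie strictly above its tangent function at their
  midpoint, whose increments towards the two cancel, so the midpoint would do better than one of
  them. If the midpoint is the origin, the minimum is zero, which only the origin attains.
\<close>

lemma minimizer_unique:
  assumes "convex K" "a \<in> K" "b \<in> K"
    and a: "\<And>z. z \<in> K \<Longrightarrow> F a \<le> F z" and b: "\<And>z. z \<in> K \<Longrightarrow> F b \<le> F z"
  shows "a = b"
proof (rule ccontr)
  assume "a \<noteq> b"
  define m where "m = midpoint a b"
  have "m \<in> K"
    using convexD[OF assms(1-3), of "1/2" "1/2"]
    by (simp add: m_def midpoint_def scaleR_add_right)
  show False
  proof (cases "m = 0")
    case True
    then have "F a \<le> 0" "F b \<le> 0"
      using a[OF \<open>m \<in> K\<close>] b[OF \<open>m \<in> K\<close>] norm_zero by auto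
    then show False
      using norm_pos[of a] norm_pos[of b] \<open>a \<noteq> b\<close> by (cases "a = 0") auto
  next
    case False
    have "a \<noteq> m" "b \<noteq> m" using \<open>a \<noteq> b\<close> unfolding m_def by (metis midpoint_eq_endpoint)+
    moreover have "(a - m) + (b - m) = 0"
      by (simp add: m_def midpoint_def algebra_simps flip: scaleR_left_distrib)
    then have "grad (energy F) m \<bullet> (a - m) + grad (energy F) m \<bullet> (b - m) = 0"
      by (metis inner_add_right inner_zero_right)
    ultimately have "energy F m < energy F a \<or> energy F m < energy F b"
      using energy_above_tangent[OF False, of a] energy_above_tangent[OF False, of b] by linarith
    then show False
      using a[OF \<open>m \<in> K\<close>] b[OF \<open>m \<in> K\<close>] energy_le_iff by (meson not_less)
  qed
qed

lemma minimizer_first_order: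
  assumes "convex K" "x \<in> K" "a \<in> K" "x \<noteq> 0"
    and min: "\<And>z. z \<in> K \<Longrightarrow> F x \<le> F z"
  shows "0 \<le> grad (energy F) x \<bullet> (a - x)"
proof (rule ccontr)
  assume "\<not> ?thesis"
  moreover have "((\<lambda>t. energy F (x + t *\<^sub>R (a - x))) has_real_derivative
      grad (energy F) x \<bullet> (a - x)) (at 0)"
    using energy_line_derivative[of x 0 "a - x"] \<open>x \<noteq> 0\<close> by simp
  ultimately obtain d where "0 < d"
    and d: "\<And>h. 0 < h \<Longrightarrow> h < d \<Longrightarrow> energy F (x + h *\<^sub>R (a - x)) < energy F x"
    using DERIV_neg_dec_right[of "\<lambda>t. energy F (x + t *\<^sub>R (a - x))" "grad (energy F) x \<bullet> (a - x)" 0]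
    by auto
  define h where "h = min 1 (d / 2)"
  have h: "0 < h" "h < d" "h \<le> 1" using \<open>0 < d\<close> by (auto simp: h_def)
  have "x + h *\<^sub>R (a - x) = (1 - h) *\<^sub>R x + h *\<^sub>R a" by (simp add: algebra_simps)
  then have "x + h *\<^sub>R (a - x) \<in> K"
    using convexD[OF assms(1-3), of "1 - h" h] h by simp
  then show False
    using min d[OF h(1,2)] energy_le_iff by (meson not_less)
qed

text \<open>
  With \<open>K = S2 - q\<close>, \<open>L = p - S1\<close> and \<open>x = p - q\<close>, the point \<open>a + b - x\<close> runs through all differences
  \<open>z2 - z1\<close>.
\<close>

lemma separate_minimizer_is_joint:
  assumes "convex K" "convex L" "x \<in> K" "x \<in> L" "a \<in> K" "b \<in> L"
    and "\<And>z. z \<in> K \<Longrightarrow> F x \<le> F z" and "\<And>z. z \<in> L \<Longrightarrow> F x \<le> F z"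
  shows "F x \<le> F (a + b - x)"
proof (cases "x = 0 \<or> a + b - x = x")
  case True
  then show ?thesis using norm_zero norm_nonneg by auto
next
  case False
  have "0 \<le> grad (energy F) x \<bullet> (a - x) + grad (energy F) x \<bullet> (b - x)"
    using False assms by (intro add_nonneg_nonneg minimizer_first_order) auto
  also have "\<dots> = grad (energy F) x \<bullet> (a + b - x - x)"
    by (simp only: flip: inner_add_right) (simp only: algebra_simps)
  finally have "energy F x \<le> energy F (a + b - x)"
    using energy_above_tangent[of x "a + b - x"] False by linarith
  then show ?thesis by (simp add: energy_le_iff)
qed


section \<open>Projections\<close>

lemma convex_reflection:
  fixes S :: "'a::real_vector set"
  assumes "convex S"
  shows "convex ((\<lambda>z. q - z) ` S)"
  using convex_translation[OF convex_negations[OF assms], of q] by (simp add: image_image)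

lemma INF_attained_iff:
  fixes f :: "'a \<Rightarrow> real"
  assumes "s \<in> S" "\<And>z. 0 \<le> f z"
  shows "f s = (INF z\<in>S. f z) \<longleftrightarrow> (\<forall>z\<in>S. f s \<le> f z)"
proof
  have "bdd_below (f ` S)" using assms(2) by (intro bdd_belowI2[of _ 0])
  then show "f s = (INF z\<in>S. f z) \<Longrightarrow> \<forall>z\<in>S. f s \<le> f z"
    by (metis cINF_lower)
  show "\<forall>z\<in>S. f s \<le> f z \<Longrightarrow> f s = (INF z\<in>S. f z)"
    using assms(1) by (intro cInf_eq_minimum[symmetric]) auto
qed

lemma fwd_proj_eq_iff:
  assumes "convex S" "proximinal F S"
  shows "s = fwd_proj F S q \<longleftrightarrow> s \<in> S \<and> (\<forall>z\<in>S. F (s - q) \<le> F (z - q))"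
proof -
  have mem: "s \<in> fwd_proj_set F S q \<longleftrightarrow> s \<in> S \<and> (\<forall>z\<in>S. F (s - q) \<le> F (z - q))" for s
    using INF_attained_iff[of s S "\<lambda>z. F (z - q)"] norm_nonneg
    by (auto simp: fwd_proj_set_def dist_F_def)
  have "s = s'" if "s \<in> fwd_proj_set F S q" "s' \<in> fwd_proj_set F S q" for s s'
    using minimizer_unique[of "(\<lambda>z. z - q) ` S" "s - q" "s' - q"] that \<open>convex S\<close>
    by (auto simp: mem convex_translation_subtract_eq)
  moreover have "fwd_proj_set F S q \<noteq> {}"
    using assms(2) by (simp add: proximinal_def)
  ultimately obtain s0 where "fwd_proj_set F S q = {s0}" by blast
  then show ?thesis using mem[of s] by (auto simp: fwd_proj_def)
qed

lemma bwd_proj_eq_iff: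
  assumes "convex S" "proximinal F S"
  shows "s = bwd_proj F S q \<longleftrightarrow> s \<in> S \<and> (\<forall>z\<in>S. F (q - s) \<le> F (q - z))"
proof -
  have mem: "s \<in> bwd_proj_set F S q \<longleftrightarrow> s \<in> S \<and> (\<forall>z\<in>S. F (q - s) \<le> F (q - z))" for s
    using INF_attained_iff[of s S "\<lambda>z. F (q - z)"] norm_nonneg
    by (auto simp: bwd_proj_set_def dist_F_def)
  have "convex ((\<lambda>z. q - z) ` S)"
    using \<open>convex S\<close> by (rule convex_reflection)
  then have "s = s'" if "s \<in> bwd_proj_set F S q" "s' \<in> bwd_proj_set F S q" for s s'
    using minimizer_unique[of "(\<lambda>z. q - z) ` S" "q - s" "q - s'"] that
    by (auto simp: mem)
  moreover have "bwd_proj_set F S q \<noteq> {}"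
    using assms(2) by (simp add: proximinal_def)
  ultimately obtain s0 where "bwd_proj_set F S q = {s0}" by blast
  then show ?thesis using mem[of s] by (auto simp: bwd_proj_def)
qed

text \<open>
  Stated for a pair in \<open>A \<times> B\<close> without fixing which end is the given point, so that it serves both
  directions of projection.
\<close>

lemma mutually_nearest_iff_distance_attained:
  assumes "convex A" "convex B" "a \<in> A" "b \<in> B"
  shows "(\<forall>z\<in>A. F (b - a) \<le> F (b - z)) \<and> (\<forall>z\<in>B. F (b - a) \<le> F (z - a)) \<longleftrightarrow>
    (\<forall>z1\<in>A. \<forall>z2\<in>B. F (b - a) \<le> F (z2 - z1))"
proof
  assume near: "(\<forall>z\<in>A. F (b - a) \<le> F (b - z)) \<and> (\<forall>z\<in>B. F (b - a) \<le> F (z - a))"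
  have K: "convex ((\<lambda>z. z - a) ` B)"
    using assms by (simp add: convex_translation_subtract_eq)
  have L: "convex ((\<lambda>z. b - z) ` A)"
    using \<open>convex A\<close> by (rule convex_reflection)
  have "F (b - a) \<le> F ((z2 - a) + (b - z1) - (b - a))" if "z1 \<in> A" "z2 \<in> B" for z1 z2
    using near that assms by (intro separate_minimizer_is_joint[OF K L]) auto
  then show "\<forall>z1\<in>A. \<forall>z2\<in>B. F (b - a) \<le> F (z2 - z1)"
    by (simp add: algebra_simps)
qed (use assms in auto)

end

theorem theorem5p1:
  fixes F :: "real^'n \<Rightarrow> real" and S1 S2 :: "(real^'n) set" and q :: "real^'n"
  assumes "minkowski_norm F"
    and "S1 \<noteq> {}" and "convex S1" and "proximinal F S1"
    and "S2 \<noteq> {}" and "convex S2" and "proximinal F S2"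
    and "q \<in> S1"
  shows "(q = (bwd_proj F S1 \<circ> fwd_proj F S2) q \<longleftrightarrow>
           (\<forall>z1\<in>S1. \<forall>z2\<in>S2. dist_F F q (fwd_proj F S2 q) \<le> dist_F F z1 z2)) \<and>
         (q = (fwd_proj F S1 \<circ> bwd_proj F S2) q \<longleftrightarrow>
           (\<forall>z1\<in>S1. \<forall>z2\<in>S2. dist_F F (bwd_proj F S2 q) q \<le> dist_F F z2 z1))"
proof
  note M = \<open>minkowski_norm F\<close>
  define p where "p = fwd_proj F S2 q"
  have p: "p \<in> S2" "\<forall>z\<in>S2. F (p - q) \<le> F (z - q)"
    using fwd_proj_eq_iff[OF M assms(6,7)] p_def by blast+
  have "q = bwd_proj F S1 p \<longleftrightarrow> (\<forall>z\<in>S1. F (p - q) \<le> F (p - z))"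
    using bwd_proj_eq_iff[OF M assms(3,4)] \<open>q \<in> S1\<close> by blast
  also have "\<dots> \<longleftrightarrow> (\<forall>z1\<in>S1. \<forall>z2\<in>S2. F (p - q) \<le> F (z2 - z1))"
    using mutually_nearest_iff_distance_attained[OF M assms(3,6) \<open>q \<in> S1\<close> p(1)] p(2) by blast
  finally show "q = (bwd_proj F S1 \<circ> fwd_proj F S2) q \<longleftrightarrow>
      (\<forall>z1\<in>S1. \<forall>z2\<in>S2. dist_F F q (fwd_proj F S2 q) \<le> dist_F F z1 z2)"
    by (simp add: dist_F_def p_def)

  define r where "r = bwd_proj F S2 q"
  have r: "r \<in> S2" "\<forall>z\<in>S2. F (q - r) \<le> F (q - z)"
    using bwd_proj_eq_iff[OF M assms(6,7)] r_def by blast+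
  have "q = fwd_proj F S1 r \<longleftrightarrow> (\<forall>z\<in>S1. F (q - r) \<le> F (z - r))"
    using fwd_proj_eq_iff[OF M assms(3,4)] \<open>q \<in> S1\<close> by blast
  also have "\<dots> \<longleftrightarrow> (\<forall>z1\<in>S1. \<forall>z2\<in>S2. F (q - r) \<le> F (z1 - z2))"
    using mutually_nearest_iff_distance_attained[OF M assms(6,3) r(1) \<open>q \<in> S1\<close>] r(2) by blast
  finally show "q = (fwd_proj F S1 \<circ> bwd_proj F S2) q \<longleftrightarrow>
      (\<forall>z1\<in>S1. \<forall>z2\<in>S2. dist_F F (bwd_proj F S2 q) q \<le> dist_F F z2 z1)"
    by (simp add: dist_F_def r_def)
qed

end
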